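(* Let $-1\le B<A\le1$, let $f\in\mathcal{S}^*(A,B)$, and let $F$ be its inverse function, valid in some neighborhood of the origin, with expansion $F(w)=w+\sum_{n=2}^{\infty}A_nw^n$. Put $\delta=(1-A)/(1-B)$, and for a fixed integer $n\ge2$ put $\mathbb{I}_k(n)=\left[\frac{k}{n},\frac{k+1}{n}\right)$, $k=0,1,\ldots,n-1$. Then: (i) if $\delta\in\mathbb{I}_0(n)\cup\mathbb{I}_1(n)$, then $$|A_n|\le\frac1n\prod_{j=0}^{n-2}\frac{n(A-B)+Bj}{j+1}; \tag{a}$$ (ii) if $\delta\in\mathbb{I}_k(n)$ for some $k\in\{2,3,\ldots,n-2\}$, then $$|A_n|\le\frac{n-k}{n(n-1)}\prod_{j=0}^{n-k-1}\frac{n(A-B)+Bj}{j+1};$$ (iii) if $\delta\in\mathbb{I}_{n-1}(n)$, then $$|A_n|\le\frac{A-B}{n-1}. \tag{b}$$ The estimates (a) and (b) are sharp.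
   Context: For $-1\le B<A\le1$, $\mathcal{S}^*(A,B)$ is the class of analytic functions $f(z)=z+\sum_{n=2}^\infty a_nz^n$ in the unit disk $\mathbb{D}=\{|z|<1\}$ satisfying $\frac{zf'(z)}{f(z)}\prec\frac{1+Az}{1+Bz}$ in $\mathbb{D}$, where $\prec$ denotes subordination of analytic functions in $\mathbb{D}$. (Note $0\le\delta<1$.) An estimate is called sharp if, for each admissible choice of $A,B,n$, equality is attained by some function in $\mathcal{S}^*(A,B)$. *)

theory Defs
  imports "HOL-Complex_Analysis.Complex_Analysis"
begin

definition subordinate :: "(complex \<Rightarrow> complex) \<Rightarrow> (complex \<Rightarrow> complex) \<Rightarrow> bool"
    (infix "\<prec>\<prec>" 50) where
  "p \<prec>\<prec> q \<longleftrightarrow>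
     p holomorphic_on ball 0 1 \<and> q holomorphic_on ball 0 1 \<and>
     (\<exists>\<omega>. \<omega> holomorphic_on ball 0 1 \<and> \<omega> 0 = 0 \<and> \<omega> ` ball 0 1 \<subseteq> ball 0 1 \<and>
          (\<forall>z\<in>ball 0 1. p z = q (\<omega> z)))"

text \<open>
  The normalisation \<open>f z = z + (\<Sum>n\<ge>2. a\<^sub>n z\<^sup>n)\<close> is \<open>f 0 = 0\<close> and \<open>f' 0 = 1\<close>.
  The quotient \<open>z f'(z) / f(z)\<close> has a removable singularity at the origin, where its value is 1;
  the condition \<open>f z \<noteq> 0\<close> says that it has no other points of indeterminacy
  (recall \<open>x / 0 = 0\<close>).
\<close>

definition janowski_starlike :: "real \<Rightarrow> real \<Rightarrow> (complex \<Rightarrow> complex) set" where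
  "janowski_starlike A B = {f.
     f holomorphic_on ball 0 1 \<and> f 0 = 0 \<and> deriv f 0 = 1 \<and>
     (\<forall>z\<in>ball 0 1 - {0}. f z \<noteq> 0) \<and>
     (\<lambda>z. if z = 0 then 1 else z * deriv f z / f z)
       \<prec>\<prec> (\<lambda>z. (1 + of_real A * z) / (1 + of_real B * z))}"

text \<open>
  \<open>F\<close> is an analytic inverse of \<open>f\<close> near the origin.  Only the germ of \<open>F\<close> at 0 matters; it is
  uniquely determined by \<open>f\<close>.
\<close>

definition local_inverse_at_0 :: "(complex \<Rightarrow> complex) \<Rightarrow> (complex \<Rightarrow> complex) \<Rightarrow> bool" where
  "local_inverse_at_0 f F \<longleftrightarrow>
     (\<exists>U V. open U \<and> open V \<and> 0 \<in> U \<and> 0 \<in> V \<and> U \<subseteq> ball 0 1 \<and>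
            homeomorphism U V f F \<and> F holomorphic_on V)"

definition taylor_coeff :: "(complex \<Rightarrow> complex) \<Rightarrow> nat \<Rightarrow> complex" where
  "taylor_coeff F n = fps_nth (fps_expansion F 0) n"

definition subinterval :: "nat \<Rightarrow> nat \<Rightarrow> real set" where
  "subinterval n k = {real k / real n ..< (real k + 1) / real n}"

end

theory Submission imports Defs begin

text \<open>
  By Lagrange inversion, \<open>n A\<^sub>n\<close> is the coefficient of order \<open>n - 1\<close> of \<open>G = (z / f)\<^sup>n\<close>
  (\<open>fps_lagrange_inversion\<close>), so it suffices to estimate the coefficients \<open>G\<^sub>k\<close>. If
  \<open>z f' / f = (1 + A \<omega>) / (1 + B \<omega>)\<close> with a Schwarz function \<open>\<omega>\<close>, then
  \<open>z G' = - \<omega> (C G + B z G')\<close> where \<open>C = n (A - B)\<close>. Such an equation expresses the coefficients of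
  \<open>z G'\<close> up to order \<open>m\<close> by those of \<open>C G + B z G'\<close> below order \<open>m\<close>, followed by multiplication by
  \<open>\<omega>\<close>, which does not increase mean squares on circles. Comparing the two mean squares
  (\<open>clunie_coefficient_inequality\<close>) gives
  \<open>m\<^sup>2 |G\<^sub>m|\<^sup>2 \<le> (\<Sum>k<m. w\<^sub>k |G\<^sub>k|\<^sup>2)\<close> with weights \<open>w\<^sub>k = (C + B k)\<^sup>2 - k\<^sup>2\<close>.

  The weights decide which of the three bounds results. The weight \<open>w\<^sub>k\<close> has the sign of
  \<open>n (1 - \<delta>) - k\<close>, so the interval containing \<open>\<delta>\<close> tells where it changes sign
  (\<open>weight_sign_change\<close>). While the weights are non-negative, induction gives
  \<open>|G\<^sub>m| \<le> (\<Prod>j<m. (C + B j) / (j + 1))\<close>, since these products satisfy the inequality with equality.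
  In the first two intervals this reaches \<open>m = n - 1\<close>, which is (a). Otherwise the terms with
  non-positive weight are dropped, and the remaining sum is again the square of a product
  (\<open>clunie_truncated_bound\<close>); in the last interval only \<open>w\<^sub>0 = C\<^sup>2\<close> remains, which is (b).

  For sharpness take \<open>\<omega> = z\<^sup>q\<close>. The equation for \<open>G\<close> becomes a recursion linking \<open>G\<^bsub>k+q\<^esub>\<close> with \<open>G\<^sub>k\<close>;
  for \<open>q = 1\<close> it produces the full product, and for \<open>q = n - 1\<close> it gives \<open>(n - 1) |G\<^bsub>n-1\<^esub>| = C\<close> in one
  step.
\<close>

(* Both vectors and power series write their components with a dollar sign. *)
unbundle no vec_syntax

section \<open>Lagrange inversion for formal power series\<close>

text \<open>
  With \<open>\<phi> = X u\<close> the product is \<open>X\<^bsup>m+1\<^esup> \<phi>' / \<phi>\<^bsup>m+1\<^esup>\<close>, so its \<open>m\<close>-th coefficient is the residue of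
  \<open>\<phi>' / \<phi>\<^bsup>m+1\<^esup>\<close>, which vanishes for \<open>m > 0\<close> because this is a derivative. Multiplying by \<open>m\<close>
  expresses this in power series only: the coefficients of order \<open>m\<close> of \<open>m v\<^sup>m\<close> and \<open>X (v\<^sup>m)'\<close>
  agree for \<open>v = 1 / u\<close>.
\<close>
lemma fps_nth_deriv_mult_inverse_power:
  fixes u :: "'a::field_char_0 fps"
  assumes u0: "u $ 0 = 1"
  shows "(fps_deriv (fps_X * u) * inverse u ^ Suc m) $ m = (if m = 0 then 1 else 0)"
proof (cases "m = 0")
  case True
  then show ?thesis using u0 by simp
next
  case False
  define v where "v = inverse u"
  have uv: "u * v = 1"
    unfolding v_def using u0 by (simp add: inverse_mult_eq_1')
  have dv: "fps_deriv v = - fps_deriv u * v\<^sup>2"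
    unfolding v_def using u0 by (intro fps_inverse_deriv) simp
  have dvm: "fps_deriv (v ^ m) = - (of_nat m * fps_deriv u * v ^ Suc m)"
  proof -
    have "fps_deriv (v ^ m) = of_nat m * fps_deriv v * v ^ (m - 1)"
      by (rule fps_deriv_power')
    also have "\<dots> = - (of_nat m * fps_deriv u * (v\<^sup>2 * v ^ (m - 1)))"
      by (simp add: dv algebra_simps)
    also have "v\<^sup>2 * v ^ (m - 1) = v ^ Suc m"
      using False by (simp flip: power_add)
    finally show ?thesis .
  qed
  have "of_nat m * (fps_deriv (fps_X * u) * v ^ Suc m)
      = of_nat m * (u * v) * v ^ m + fps_X * (of_nat m * fps_deriv u * v ^ Suc m)"
    by (simp add: algebra_simps)
  also have "\<dots> = of_nat m * v ^ m - fps_X * fps_deriv (v ^ m)"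
    by (simp add: uv dvm)
  finally have "(of_nat m * (fps_deriv (fps_X * u) * v ^ Suc m)) $ m
      = (of_nat m * v ^ m - fps_X * fps_deriv (v ^ m)) $ m"
    by simp
  also have "\<dots> = 0"
    using False by simp
  finally have "of_nat m * (fps_deriv (fps_X * u) * v ^ Suc m) $ m = 0"
    by simp
  then show ?thesis
    using False unfolding v_def by simp
qed

text \<open>
  Differentiating \<open>\<Psi> \<circ> \<phi> = X\<close> gives \<open>(\<Psi>' \<circ> \<phi>) \<phi>' / \<phi>\<^sup>n = 1 / \<phi>\<^sup>n\<close>; compare residues. On the left, only
  the term \<open>n \<Psi>\<^sub>n \<phi>\<^bsup>n-1\<^esup>\<close> of \<open>\<Psi>' \<circ> \<phi>\<close> contributes.
\<close>
lemma fps_lagrange_inversion: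
  fixes u \<Psi> :: "'a::field_char_0 fps"
  assumes u0: "u $ 0 = 1" and inv: "\<Psi> oo (fps_X * u) = fps_X" and n: "n \<ge> 1"
  shows "of_nat n * \<Psi> $ n = (inverse u ^ n) $ (n - 1)"
proof -
  define \<phi> where "\<phi> = fps_X * u"
  define v where "v = inverse u"
  define H where "H = fps_deriv \<Psi>"
  define W where "W = fps_deriv \<phi> * v ^ n"
  have uv: "u * v = 1"
    unfolding v_def using u0 by (simp add: inverse_mult_eq_1')
  have \<phi>0: "\<phi> $ 0 = 0"
    by (simp add: \<phi>_def)
  have "fps_deriv (\<Psi> oo \<phi>) = (H oo \<phi>) * fps_deriv \<phi>"
    unfolding H_def by (rule fps_compose_deriv) (rule \<phi>0)
  moreover have "fps_deriv (\<Psi> oo \<phi>) = 1"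
    using inv by (simp add: \<phi>_def)
  ultimately have HW: "(H oo \<phi>) * W = v ^ n"
    by (metis W_def mult.assoc mult_1)
  have low: "\<phi> ^ k $ i = 0" if "i < k" for k i
    using that by (simp add: \<phi>_def power_mult_distrib fps_X_power_mult_nth)
  (* As powers above i do not reach order i, one range of summation serves all coefficients,
     and the two sums below can be exchanged. *)
  have Hnth: "(H oo \<phi>) $ i = (\<Sum>k=0..n-1. H $ k * \<phi> ^ k $ i)" if "i \<le> n - 1" for i
    unfolding fps_compose_nth using that low by (intro sum.mono_neutral_left) auto
  have coeff: "(\<phi> ^ k * W) $ (n - 1) = (if k = n - 1 then 1 else 0)" if k: "k \<le> n - 1" for k
  proof -
    have "\<phi> ^ k * v ^ n = fps_X ^ k * (u * v) ^ k * v ^ (n - k)"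
      using k by (simp add: \<phi>_def power_mult_distrib mult.assoc flip: power_add)
    then have "\<phi> ^ k * W = fps_X ^ k * (fps_deriv \<phi> * v ^ Suc (n - 1 - k))"
      using k n by (simp add: W_def uv mult.left_commute Suc_diff_Suc del: power_Suc)
    then have "(\<phi> ^ k * W) $ (n - 1) = (fps_deriv \<phi> * v ^ Suc (n - 1 - k)) $ (n - 1 - k)"
      using k by (simp add: fps_X_power_mult_nth del: power_Suc)
    then show ?thesis
      using fps_nth_deriv_mult_inverse_power[OF u0, of "n - 1 - k"] k
      unfolding \<phi>_def v_def by auto
  qed
  have "(inverse u ^ n) $ (n - 1) = (\<Sum>i=0..n-1. (H oo \<phi>) $ i * W $ (n - 1 - i))"
    unfolding v_def[symmetric] HW[symmetric] by (rule fps_mult_nth)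
  also have "\<dots> = (\<Sum>i=0..n-1. \<Sum>k=0..n-1. H $ k * (\<phi> ^ k $ i * W $ (n - 1 - i)))"
    by (intro sum.cong refl) (simp add: Hnth sum_distrib_right mult.assoc)
  also have "\<dots> = (\<Sum>k=0..n-1. H $ k * (\<phi> ^ k * W) $ (n - 1))"
    by (subst sum.swap) (simp add: fps_mult_nth sum_distrib_left)
  also have "\<dots> = (\<Sum>k=0..n-1. if k = n - 1 then H $ k else 0)"
    by (intro sum.cong refl) (simp add: coeff del: One_nat_def)
  also have "\<dots> = of_nat n * \<Psi> $ n"
    using n by (simp add: H_def)
  finally show ?thesis ..
qed

section \<open>Mean squares on circles\<close>

text \<open>
  On \<open>|w| = r\<close> the conjugate of \<open>w\<^sup>k\<close> is \<open>r\<^sup>2\<^sup>k / w\<^sup>k\<close>, so this mean value is Cauchy's formula for the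
  \<open>k\<close>-th Taylor coefficient.
\<close>
lemma has_integral_mult_cnj_power_circlepath:
  assumes h: "h holomorphic_on ball 0 1" and r: "0 < r" "r < 1"
  shows "((\<lambda>t. h (circlepath 0 r t) * cnj (circlepath 0 r t ^ k)) has_integral
            of_real (r ^ (2 * k)) * fps_expansion h 0 $ k) {0..1}"
proof -
  define w where "w = circlepath 0 r"
  have nw: "norm (w t) = r" for t
    using r by (simp add: w_def circlepath norm_mult)
  have w0: "w t \<noteq> 0" for t
    using nw[of t] r by auto
  have cw: "cnj (w t ^ k) = of_real (r ^ (2 * k)) / w t ^ k" for t
  proof -
    have "w t ^ k * cnj (w t ^ k) = of_real (r ^ (2 * k))"
      unfolding complex_norm_square[symmetric] norm_power nw
      by (simp add: power_mult mult.commute flip: power_mult)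
    then show ?thesis using w0[of t] by (simp add: field_simps)
  qed
  have "((\<lambda>u. h u / (u - 0) ^ Suc k) has_contour_integral
           (2 * pi * \<i>) / fact k * (deriv ^^ k) h 0) (circlepath 0 r)"
  proof (rule Cauchy_has_contour_integral_higher_derivative_circlepath)
    show "h holomorphic_on ball 0 r" "continuous_on (cball 0 r) h"
      using r h by (auto intro!: holomorphic_on_imp_continuous_on elim!: holomorphic_on_subset)
  qed (use r in auto)
  then have "((\<lambda>t. h (w t) / w t ^ Suc k * vector_derivative w (at t within {0..1})) has_integral
           (2 * pi * \<i>) / fact k * (deriv ^^ k) h 0) {0..1}"
    by (simp add: has_contour_integral_def w_def)
  then have "((\<lambda>t. h (w t) / w t ^ k * (2 * pi * \<i>)) has_integral
           (2 * pi * \<i>) / fact k * (deriv ^^ k) h 0) {0..1}"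
  proof (rule has_integral_eq[rotated])
    fix t :: real assume t: "t \<in> {0..1}"
    have "vector_derivative w (at t within {0..1}) = 2 * pi * \<i> * w t"
      unfolding w_def using t by (subst vector_derivative_circlepath01) (auto simp: circlepath)
    then show "h (w t) / w t ^ Suc k * vector_derivative w (at t within {0..1})
             = h (w t) / w t ^ k * (2 * pi * \<i>)"
      using w0[of t] by (simp add: field_simps)
  qed
  then have "((\<lambda>t. h (w t) / w t ^ k * (2 * pi * \<i>) * (of_real (r ^ (2 * k)) / (2 * pi * \<i>))) has_integral
       (2 * pi * \<i>) / fact k * (deriv ^^ k) h 0 * (of_real (r ^ (2 * k)) / (2 * pi * \<i>))) {0..1}"
    by (rule has_integral_mult_left)
  then show ?thesis
    unfolding w_def[symmetric] cw by (simp add: fps_expansion_def field_simps)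
qed

lemma has_integral_mult_cnj_polynomial_circlepath:
  fixes d :: "nat \<Rightarrow> complex"
  assumes "h holomorphic_on ball 0 1" and "0 < r" "r < 1" and "finite K"
  shows "((\<lambda>t. h (circlepath 0 r t) * cnj (\<Sum>k\<in>K. d k * circlepath 0 r t ^ k)) has_integral
            (\<Sum>k\<in>K. cnj (d k) * (of_real (r ^ (2 * k)) * fps_expansion h 0 $ k))) {0..1}"
proof -
  have "((\<lambda>t. \<Sum>k\<in>K. cnj (d k) * (h (circlepath 0 r t) * cnj (circlepath 0 r t ^ k))) has_integral
            (\<Sum>k\<in>K. cnj (d k) * (of_real (r ^ (2 * k)) * fps_expansion h 0 $ k))) {0..1}"
    using assms
    by (intro has_integral_sum has_integral_mult_right has_integral_mult_cnj_power_circlepath)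
  then show ?thesis
    by (simp add: sum_distrib_left algebra_simps)
qed

lemma fps_expansion_polynomial_nth:
  fixes d :: "nat \<Rightarrow> complex"
  assumes "finite K"
  shows "fps_expansion (\<lambda>z. \<Sum>k\<in>K. d k * z ^ k) 0 $ i = (if i \<in> K then d i else 0)"
proof -
  have "(\<lambda>z. \<Sum>k\<in>K. d k * z ^ k) has_fps_expansion (\<Sum>k\<in>K. fps_const (d k) * fps_X ^ k)"
    by (intro fps_expansion_intros)
  then have "fps_expansion (\<lambda>z. \<Sum>k\<in>K. d k * z ^ k) 0 = (\<Sum>k\<in>K. fps_const (d k) * fps_X ^ k)"
    by (rule fps_expansion_eqI)
  then show ?thesis
    using assms by (simp add: fps_sum_nth fps_X_power_nth if_distrib cong: if_cong)
qed

lemma has_integral_norm_square_polynomial_circlepath: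
  fixes d :: "nat \<Rightarrow> complex"
  assumes "0 < r" "r < 1" and "finite K"
  shows "((\<lambda>t. (norm (\<Sum>k\<in>K. d k * circlepath 0 r t ^ k))\<^sup>2) has_integral
            (\<Sum>k\<in>K. (norm (d k))\<^sup>2 * r ^ (2 * k))) {0..1}"
proof -
  define D where "D = (\<lambda>z. \<Sum>k\<in>K. d k * z ^ k)"
  have "D holomorphic_on ball 0 1"
    unfolding D_def by (intro holomorphic_intros)
  from has_integral_mult_cnj_polynomial_circlepath[OF this assms, of d]
  have "((\<lambda>t. D (circlepath 0 r t) * cnj (D (circlepath 0 r t))) has_integral
            (\<Sum>k\<in>K. cnj (d k) * (of_real (r ^ (2 * k)) * fps_expansion D 0 $ k))) {0..1}"
    by (simp add: D_def)
  also have "(\<Sum>k\<in>K. cnj (d k) * (of_real (r ^ (2 * k)) * fps_expansion D 0 $ k))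
           = of_real (\<Sum>k\<in>K. (norm (d k))\<^sup>2 * r ^ (2 * k))"
    unfolding of_real_sum D_def
    by (intro sum.cong refl)
       (simp add: fps_expansion_polynomial_nth[OF assms(3)] complex_norm_square del: of_real_power)
  finally have "((\<lambda>t. complex_of_real ((norm (D (circlepath 0 r t)))\<^sup>2)) has_integral
            of_real (\<Sum>k\<in>K. (norm (d k))\<^sup>2 * r ^ (2 * k))) {0..1}"
    by (simp only: complex_norm_square)
  from has_integral_Re[OF this] show ?thesis
    by (simp add: D_def)
qed

text \<open>
  Bessel's inequality for the orthogonal system \<open>w\<^sup>k\<close> on the circle: expand the mean of \<open>|h - D|\<^sup>2 \<ge> 0\<close>,
  where \<open>D\<close> is the Taylor polynomial of \<open>h\<close>.
\<close>
lemma bessel_circlepath: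
  assumes h: "h holomorphic_on ball 0 1" and r: "0 < r" "r < 1"
  shows "(\<Sum>k\<le>N. (norm (fps_expansion h 0 $ k))\<^sup>2 * r ^ (2 * k))
           \<le> integral {0..1} (\<lambda>t. (norm (h (circlepath 0 r t)))\<^sup>2)"
proof -
  define c where "c = (\<lambda>k. fps_expansion h 0 $ k)"
  define w where "w = circlepath 0 r"
  define D where "D = (\<lambda>z. \<Sum>k\<le>N. c k * z ^ k)"
  define S where "S = (\<Sum>k\<le>N. (norm (c k))\<^sup>2 * r ^ (2 * k))"
  have "continuous_on {0..1} (\<lambda>t. h (w t))"
  proof (rule continuous_on_compose2[of "ball 0 1" h _ w])
    show "continuous_on {0..1} w"
      unfolding w_def circlepath by (intro continuous_intros)
    show "w ` {0..1} \<subseteq> ball 0 1"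
      using r by (auto simp: w_def circlepath norm_mult)
  qed (rule holomorphic_on_imp_continuous_on[OF h])
  then have int_h: "((\<lambda>t. (norm (h (w t)))\<^sup>2) has_integral integral {0..1} (\<lambda>t. (norm (h (w t)))\<^sup>2)) {0..1}"
    by (intro integrable_integral integrable_continuous_real continuous_intros)
  have "((\<lambda>t. h (w t) * cnj (D (w t))) has_integral
          (\<Sum>k\<le>N. cnj (c k) * (of_real (r ^ (2 * k)) * c k))) {0..1}"
    using has_integral_mult_cnj_polynomial_circlepath[OF h r, of "{..N}" c]
    by (simp add: w_def c_def D_def)
  also have "(\<Sum>k\<le>N. cnj (c k) * (of_real (r ^ (2 * k)) * c k)) = of_real S"
    unfolding S_def of_real_sum
    by (intro sum.cong refl) (simp add: complex_norm_square del: of_real_power)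
  finally have int_hD: "((\<lambda>t. Re (h (w t) * cnj (D (w t)))) has_integral S) {0..1}"
    by (auto dest: has_integral_Re)
  have int_D: "((\<lambda>t. (norm (D (w t)))\<^sup>2) has_integral S) {0..1}"
    using has_integral_norm_square_polynomial_circlepath[OF r, of "{..N}" c]
    by (simp add: S_def D_def w_def)
  have expand: "(norm (a - b))\<^sup>2 = (norm a)\<^sup>2 - 2 * Re (a * cnj b) + (norm b)\<^sup>2" for a b :: complex
    unfolding cmod_power2 by (simp add: power2_eq_square algebra_simps)
  have "((\<lambda>t. (norm (h (w t) - D (w t)))\<^sup>2) has_integral
          integral {0..1} (\<lambda>t. (norm (h (w t)))\<^sup>2) - 2 * S + S) {0..1}"
    unfolding expand
    by (intro has_integral_add has_integral_diff has_integral_mult_right int_h int_hD int_D)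
  then have "0 \<le> integral {0..1} (\<lambda>t. (norm (h (w t)))\<^sup>2) - 2 * S + S"
    by (rule has_integral_nonneg) simp
  then show ?thesis
    by (simp add: S_def c_def w_def)
qed

text \<open>
  On \<open>|w| = r\<close> the factor \<open>\<omega>\<close> does not increase the mean square, and Bessel's inequality bounds the
  coefficients of the product by it; then let \<open>r\<close> tend to 1, as \<open>\<omega>\<close> need not extend to the boundary.
\<close>
lemma sum_norm_coeff_bounded_mult_le:
  fixes e :: "nat \<Rightarrow> complex"
  assumes \<omega>: "\<omega> holomorphic_on ball 0 1" and bd: "\<And>z. z \<in> ball 0 1 \<Longrightarrow> norm (\<omega> z) \<le> 1"
    and K: "finite K"
  shows "(\<Sum>k\<le>N. (norm (fps_expansion (\<lambda>z. \<omega> z * (\<Sum>k\<in>K. e k * z ^ k)) 0 $ k))\<^sup>2)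
           \<le> (\<Sum>k\<in>K. (norm (e k))\<^sup>2)"
proof -
  define E where "E = (\<lambda>z. \<Sum>k\<in>K. e k * z ^ k)"
  define h where "h = (\<lambda>z. \<omega> z * E z)"
  have hh: "h holomorphic_on ball 0 1"
    unfolding h_def E_def by (intro holomorphic_intros \<omega>)
  have le: "(\<Sum>k\<le>N. (norm (fps_expansion h 0 $ k))\<^sup>2 * r ^ (2 * k)) \<le> (\<Sum>k\<in>K. (norm (e k))\<^sup>2 * r ^ (2 * k))"
    if r: "0 < r" "r < 1" for r
  proof -
    have "(\<Sum>k\<le>N. (norm (fps_expansion h 0 $ k))\<^sup>2 * r ^ (2 * k))
           \<le> integral {0..1} (\<lambda>t. (norm (h (circlepath 0 r t)))\<^sup>2)"
      by (rule bessel_circlepath[OF hh r])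
    also have "\<dots> \<le> integral {0..1} (\<lambda>t. (norm (E (circlepath 0 r t)))\<^sup>2)"
    proof (rule integral_le)
      have in_ball: "circlepath 0 r t \<in> ball 0 1" for t
        using r by (simp add: circlepath norm_mult)
      have cont: "continuous_on {0..1} (circlepath 0 r)"
        unfolding circlepath by (intro continuous_intros)
      show "(\<lambda>t. (norm (h (circlepath 0 r t)))\<^sup>2) integrable_on {0..1}"
        by (intro integrable_continuous_real continuous_intros
              continuous_on_compose2[OF holomorphic_on_imp_continuous_on[OF hh] cont])
           (use in_ball in auto)
      show "(\<lambda>t. (norm (E (circlepath 0 r t)))\<^sup>2) integrable_on {0..1}"
        using has_integral_norm_square_polynomial_circlepath[OF r K]
        unfolding E_def by blast
      fix t :: real
      have "norm (h (circlepath 0 r t)) \<le> 1 * norm (E (circlepath 0 r t))"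
        unfolding h_def norm_mult by (intro mult_right_mono bd in_ball) simp
      then show "(norm (h (circlepath 0 r t)))\<^sup>2 \<le> (norm (E (circlepath 0 r t)))\<^sup>2"
        by (intro power_mono) auto
    qed
    also have "\<dots> = (\<Sum>k\<in>K. (norm (e k))\<^sup>2 * r ^ (2 * k))"
      unfolding E_def
      by (rule integral_unique[OF has_integral_norm_square_polynomial_circlepath[OF r K]])
    finally show ?thesis .
  qed
  have lim: "((\<lambda>r. \<Sum>k\<in>L. a k * r ^ (2 * k)) \<longlongrightarrow> (\<Sum>k\<in>L. a k)) (at_left 1)"
    for a :: "nat \<Rightarrow> real" and L
  proof -
    have "((\<lambda>r. \<Sum>k\<in>L. a k * r ^ (2 * k)) \<longlongrightarrow> (\<Sum>k\<in>L. a k * 1 ^ (2 * k))) (at_left 1)"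
      by (intro tendsto_intros)
    then show ?thesis by simp
  qed
  have "\<forall>\<^sub>F r in at_left 1. r \<in> {0<..<1::real}"
    by (rule eventually_at_leftI[of 0]) auto
  then have "(\<Sum>k\<le>N. (norm (fps_expansion h 0 $ k))\<^sup>2) \<le> (\<Sum>k\<in>K. (norm (e k))\<^sup>2)"
    by (intro tendsto_le[OF _ lim lim]) (auto elim!: eventually_mono intro: le)
  then show ?thesis
    by (simp add: h_def E_def)
qed

section \<open>Clunie's method\<close>

text \<open>
  Write the equation as \<open>X G' = \<Omega> Q\<close> with \<open>Q = - (c G + b X G')\<close>. As \<open>\<Omega>\<close> has no constant term, the
  coefficients of \<open>\<Omega> Q\<close> up to order \<open>m\<close> do not change when \<open>Q\<close> is cut off before order \<open>m\<close>, and
  multiplication by \<open>\<omega>\<close> is a contraction in mean square. Only the polynomial that is left of \<open>Q\<close> has to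
  be evaluated, so \<open>G\<close> may be a formal series.
\<close>
lemma clunie_coefficient_inequality:
  fixes G :: "complex fps" and c b :: complex
  assumes \<omega>: "\<omega> holomorphic_on ball 0 1" "\<omega> 0 = 0" "\<omega> ` ball 0 1 \<subseteq> ball 0 1"
    and eq: "fps_X * fps_deriv G
           = - (fps_expansion \<omega> 0 * (fps_const c * G + fps_const b * (fps_X * fps_deriv G)))"
  shows "(\<Sum>k\<le>m. (real k)\<^sup>2 * (norm (G $ k))\<^sup>2)
           \<le> (\<Sum>k<m. (norm (c + b * of_nat k))\<^sup>2 * (norm (G $ k))\<^sup>2)"
proof -
  define \<Omega> where "\<Omega> = fps_expansion \<omega> 0"
  define Q where "Q = - (fps_const c * G + fps_const b * (fps_X * fps_deriv G))"
  define E where "E = (\<lambda>z. \<Sum>k<m. Q $ k * z ^ k)"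
  have XG: "(fps_X * fps_deriv G) $ k = of_nat k * G $ k" for k
    by (cases k) simp_all
  have Qnth: "Q $ k = - ((c + b * of_nat k) * G $ k)" for k
    by (simp add: Q_def XG algebra_simps)
  have \<Omega>: "\<omega> has_fps_expansion \<Omega>"
    unfolding \<Omega>_def using \<omega>(1) by (intro has_fps_expansion_fps_expansion[of "ball 0 1"]) auto
  have \<Omega>0: "\<Omega> $ 0 = 0"
    using has_fps_expansion_imp_0_eq_fps_nth_0[OF \<Omega>] \<omega>(2) by simp
  have "E holomorphic_on ball 0 1"
    unfolding E_def by (intro holomorphic_intros)
  then have "E has_fps_expansion fps_expansion E 0"
    by (intro has_fps_expansion_fps_expansion[of "ball 0 1"]) auto
  then have \<Omega>E: "fps_expansion (\<lambda>z. \<omega> z * E z) 0 = \<Omega> * fps_expansion E 0"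
    by (intro fps_expansion_eqI has_fps_expansion_mult \<Omega>)
  have coeff: "fps_expansion (\<lambda>z. \<omega> z * E z) 0 $ k = of_nat k * G $ k" if k: "k \<le> m" for k
  proof -
    have "of_nat k * G $ k = (fps_X * fps_deriv G) $ k"
      by (rule XG[symmetric])
    also have "\<dots> = (\<Omega> * Q) $ k"
      by (subst eq) (simp only: Q_def \<Omega>_def mult_minus_right)
    also have "\<dots> = (\<Omega> * fps_expansion E 0) $ k"
      unfolding fps_mult_nth
    proof (intro sum.cong refl)
      fix i assume "i \<in> {0..k}"
      then show "\<Omega> $ i * Q $ (k - i) = \<Omega> $ i * fps_expansion E 0 $ (k - i)"
        using k unfolding E_def
        by (cases "i = 0") (auto simp: \<Omega>0 fps_expansion_polynomial_nth)
    qed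
    finally show ?thesis
      by (simp add: \<Omega>E)
  qed
  have "(\<Sum>k\<le>m. (real k)\<^sup>2 * (norm (G $ k))\<^sup>2)
      = (\<Sum>k\<le>m. (norm (fps_expansion (\<lambda>z. \<omega> z * E z) 0 $ k))\<^sup>2)"
    by (intro sum.cong refl) (simp add: coeff norm_mult power_mult_distrib)
  also have "\<dots> \<le> (\<Sum>k<m. (norm (Q $ k))\<^sup>2)"
  proof -
    have "norm (\<omega> z) \<le> 1" if "z \<in> ball 0 1" for z
      using \<omega>(3) that by (auto simp: image_subset_iff less_imp_le)
    from sum_norm_coeff_bounded_mult_le[OF \<omega>(1) this, where K = "{..<m}" and N = m and e = "\<lambda>k. Q $ k"]
    show ?thesis
      by (simp add: E_def)
  qed
  also have "\<dots> = (\<Sum>k<m. (norm (c + b * of_nat k))\<^sup>2 * (norm (G $ k))\<^sup>2)"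
    by (simp add: Qnth norm_mult power_mult_distrib)
  finally show ?thesis .
qed

text \<open>
  The products solve the recursion \<open>(m + 1) P\<^bsub>m+1\<^esub> = (C + B m) P\<^sub>m\<close>, which is Clunie's case \<open>\<omega> = - z\<close>.
  There multiplication by \<open>\<omega>\<close> preserves mean squares, so the inequality becomes an identity.
\<close>
lemma square_mult_prod_eq_sum:
  fixes C B :: real
  shows "(real m)\<^sup>2 * (\<Prod>j<m. (C + B * real j) / (real j + 1))\<^sup>2
       = (\<Sum>k<m. ((C + B * real k)\<^sup>2 - (real k)\<^sup>2) * (\<Prod>j<k. (C + B * real j) / (real j + 1))\<^sup>2)"
proof (induction m)
  case (Suc m)
  define P where "P = (\<lambda>m. \<Prod>j<m. (C + B * real j) / (real j + 1))"
  have "real (Suc m) * P (Suc m) = (C + B * real m) * P m"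
    by (simp add: P_def field_simps)
  then have "(real (Suc m))\<^sup>2 * (P (Suc m))\<^sup>2 = (C + B * real m)\<^sup>2 * (P m)\<^sup>2"
    by (metis power_mult_distrib)
  also have "\<dots> = (real m)\<^sup>2 * (P m)\<^sup>2 + ((C + B * real m)\<^sup>2 - (real m)\<^sup>2) * (P m)\<^sup>2"
    by (simp add: left_diff_distrib)
  finally show ?case
    unfolding sum.lessThan_Suc Suc.IH[symmetric] by (simp only: P_def)
qed simp

text \<open>
  Non-negative weights let the bounds for \<open>x k\<close> with \<open>k < m\<close> be inserted, and the resulting sum is the
  one evaluated above.
\<close>
lemma clunie_product_bound:
  fixes C B :: real and x :: "nat \<Rightarrow> real"
  assumes x: "\<And>m. (real m)\<^sup>2 * (x m)\<^sup>2 \<le> (\<Sum>k<m. ((C + B * real k)\<^sup>2 - (real k)\<^sup>2) * (x k)\<^sup>2)"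
    and x0: "(x 0)\<^sup>2 = 1"
    and pos: "\<And>k. k < m \<Longrightarrow> (real k)\<^sup>2 \<le> (C + B * real k)\<^sup>2"
  shows "(x m)\<^sup>2 \<le> (\<Prod>j<m. (C + B * real j) / (real j + 1))\<^sup>2"
  using pos
proof (induction m rule: less_induct)
  case (less m)
  show ?case
  proof (cases "m = 0")
    case False
    have "(real m)\<^sup>2 * (x m)\<^sup>2
        \<le> (\<Sum>k<m. ((C + B * real k)\<^sup>2 - (real k)\<^sup>2) * (\<Prod>j<k. (C + B * real j) / (real j + 1))\<^sup>2)"
      using less by (intro order.trans[OF x] sum_mono mult_left_mono) auto
    also have "\<dots> = (real m)\<^sup>2 * (\<Prod>j<m. (C + B * real j) / (real j + 1))\<^sup>2"
      by (rule square_mult_prod_eq_sum[symmetric])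
    finally show ?thesis
      using False by simp
  qed (simp add: x0)
qed

text \<open>
  If the weights \<open>(C + B k)\<^sup>2 - k\<^sup>2\<close> change sign only once, at \<open>k = p\<close>, then dropping the non-positive
  ones and estimating the other terms by the products sums up to the product of length \<open>p\<close> again.
\<close>
lemma clunie_truncated_bound:
  fixes C B :: real and x :: "nat \<Rightarrow> real"
  assumes x: "\<And>m. (real m)\<^sup>2 * (x m)\<^sup>2 \<le> (\<Sum>k<m. ((C + B * real k)\<^sup>2 - (real k)\<^sup>2) * (x k)\<^sup>2)"
    and x0: "(x 0)\<^sup>2 = 1"
    and pos: "\<And>k. k < p \<Longrightarrow> (real k)\<^sup>2 \<le> (C + B * real k)\<^sup>2"
    and neg: "\<And>k. p \<le> k \<Longrightarrow> (C + B * real k)\<^sup>2 \<le> (real k)\<^sup>2"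
    and pm: "p \<le> m"
  shows "(real m * x m)\<^sup>2 \<le> (real p * (\<Prod>j<p. (C + B * real j) / (real j + 1)))\<^sup>2"
proof -
  have "(real m * x m)\<^sup>2 \<le> (\<Sum>k<m. ((C + B * real k)\<^sup>2 - (real k)\<^sup>2) * (x k)\<^sup>2)"
    using x by (simp add: power_mult_distrib)
  also have "\<dots> = (\<Sum>k<p. ((C + B * real k)\<^sup>2 - (real k)\<^sup>2) * (x k)\<^sup>2)
                + (\<Sum>k\<in>{p..<m}. ((C + B * real k)\<^sup>2 - (real k)\<^sup>2) * (x k)\<^sup>2)"
    using pm by (subst sum.union_disjoint[symmetric]) (auto intro!: sum.cong)
  also have "\<dots> \<le> (\<Sum>k<p. ((C + B * real k)\<^sup>2 - (real k)\<^sup>2) * (x k)\<^sup>2)"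
  proof -
    have "(\<Sum>k\<in>{p..<m}. ((C + B * real k)\<^sup>2 - (real k)\<^sup>2) * (x k)\<^sup>2) \<le> 0"
      using neg by (intro sum_nonpos mult_nonpos_nonneg) auto
    then show ?thesis by simp
  qed
  also have "\<dots> \<le> (\<Sum>k<p. ((C + B * real k)\<^sup>2 - (real k)\<^sup>2)
                        * (\<Prod>j<k. (C + B * real j) / (real j + 1))\<^sup>2)"
    using pos by (intro sum_mono mult_left_mono clunie_product_bound x x0) auto
  also have "\<dots> = (real p * (\<Prod>j<p. (C + B * real j) / (real j + 1)))\<^sup>2"
    by (simp add: square_mult_prod_eq_sum[symmetric] power_mult_distrib)
  finally show ?thesis .
qed

section \<open>From a starlike function to the coefficients of its inverse\<close>

text \<open>
  The starlikeness equation for \<open>X u\<close> is a linear equation for \<open>u\<close>, and taking logarithmic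
  derivatives turns it into one of the same kind for \<open>u\<^sup>-\<^sup>n\<close>.
\<close>
lemma fps_starlike_equation_inverse_power:
  fixes u \<Omega> :: "'a::field_char_0 fps" and a b :: 'a
  assumes u0: "u $ 0 = 1" and n: "n \<ge> 1"
    and eq: "fps_X * fps_deriv (fps_X * u) * (1 + fps_const b * \<Omega>) = fps_X * u * (1 + fps_const a * \<Omega>)"
  shows "fps_X * fps_deriv (inverse u ^ n)
       = - (\<Omega> * (fps_const (of_nat n * (a - b)) * inverse u ^ n
                + fps_const b * (fps_X * fps_deriv (inverse u ^ n))))"
proof -
  define v where "v = inverse u"
  have uv: "u * v = 1"
    unfolding v_def using u0 by (simp add: inverse_mult_eq_1')
  have dv: "fps_deriv v = - fps_deriv u * v\<^sup>2"
    unfolding v_def using u0 by (intro fps_inverse_deriv) simp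
  have "fps_deriv (v ^ n) = of_nat n * fps_deriv v * v ^ (n - 1)"
    by (rule fps_deriv_power')
  also have "\<dots> = - (of_nat n * fps_deriv u * (v\<^sup>2 * v ^ (n - 1)))"
    by (simp add: dv algebra_simps)
  also have "v\<^sup>2 * v ^ (n - 1) = v * v ^ n"
    using n by (simp flip: power_add power_Suc)
  finally have dvn: "fps_deriv (v ^ n) = - (of_nat n * fps_deriv u * (v * v ^ n))" .
  have "fps_X * ((u + fps_X * fps_deriv u) * (1 + fps_const b * \<Omega>)) = fps_X * (u * (1 + fps_const a * \<Omega>))"
    using eq by (simp add: algebra_simps)
  then have "(u + fps_X * fps_deriv u) * (1 + fps_const b * \<Omega>) = u * (1 + fps_const a * \<Omega>)"
    by simp
  then have du: "fps_X * fps_deriv u * (1 + fps_const b * \<Omega>) = (fps_const a - fps_const b) * \<Omega> * u"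
    by (simp add: algebra_simps del: fps_const_sub)
  have "fps_X * fps_deriv (v ^ n) * (1 + fps_const b * \<Omega>)
      = - (of_nat n * v * v ^ n * (fps_X * fps_deriv u * (1 + fps_const b * \<Omega>)))"
    by (simp add: dvn algebra_simps)
  also have "\<dots> = - (of_nat n * (fps_const a - fps_const b) * \<Omega> * v ^ n * (u * v))"
    unfolding du by (simp only: mult_ac)
  also have "\<dots> = - (\<Omega> * (fps_const (of_nat n * (a - b)) * v ^ n))"
    by (simp add: uv mult_ac fps_of_nat flip: fps_const_mult fps_const_sub)
  finally have lin: "fps_X * fps_deriv (v ^ n) * (1 + fps_const b * \<Omega>)
      = - (\<Omega> * (fps_const (of_nat n * (a - b)) * v ^ n))" .
  have "fps_X * fps_deriv (v ^ n) = fps_X * fps_deriv (v ^ n) * (1 + fps_const b * \<Omega>)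
      - \<Omega> * (fps_const b * (fps_X * fps_deriv (v ^ n)))"
    by (simp add: distrib_left mult_ac)
  also note lin
  finally show ?thesis
    unfolding v_def by (simp add: distrib_left)
qed

lemma fps_expansion_local_inverse:
  assumes f: "f holomorphic_on ball 0 1" "f 0 = 0" and F: "local_inverse_at_0 f F"
  shows "fps_expansion F 0 oo fps_expansion f 0 = fps_X"
proof -
  from F obtain U V where U: "open U" "0 \<in> U" and V: "open V" "0 \<in> V" "F holomorphic_on V"
    and hom: "homeomorphism U V f F"
    unfolding local_inverse_at_0_def by blast
  have fe: "f has_fps_expansion fps_expansion f 0"
    using f by (intro has_fps_expansion_fps_expansion[of "ball 0 1"]) auto
  have "F has_fps_expansion fps_expansion F 0"
    using V by (intro has_fps_expansion_fps_expansion)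
  then have "(F \<circ> f) has_fps_expansion (fps_expansion F 0 oo fps_expansion f 0)"
    using fe has_fps_expansion_imp_0_eq_fps_nth_0[OF fe] f(2)
    by (intro has_fps_expansion_compose) auto
  moreover have "(F \<circ> f) has_fps_expansion fps_X"
  proof -
    have "\<forall>\<^sub>F z in nhds 0. z \<in> U"
      using U by (rule eventually_nhds_in_open)
    then have "\<forall>\<^sub>F z in nhds 0. (F \<circ> f) z = z"
      by eventually_elim (use hom in \<open>auto simp: homeomorphism_def\<close>)
    then show ?thesis
      by (rule iffD2[OF has_fps_expansion_cong[OF _ refl] has_fps_expansion_fps_X])
  qed
  ultimately show ?thesis
    by (rule fps_expansion_unique_complex)
qed

text \<open>
  The series \<open>G\<close> is the expansion of \<open>(z / f z)\<^sup>n\<close>. The claims concern the germ of \<open>f\<close> at 0 only,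
  so it is enough to pass to power series there.
\<close>
lemma inverse_coefficient_equation:
  fixes a b :: complex
  assumes f: "f holomorphic_on ball 0 1" "f 0 = 0" "deriv f 0 = 1"
    and F: "local_inverse_at_0 f F" and n: "n \<ge> 1"
    and \<omega>: "\<omega> holomorphic_on ball 0 1"
    and eq: "\<And>z. z \<in> ball 0 1 \<Longrightarrow> z * deriv f z * (1 + b * \<omega> z) = f z * (1 + a * \<omega> z)"
  obtains G where "G $ 0 = 1" and "of_nat n * taylor_coeff F n = G $ (n - 1)"
    and "fps_X * fps_deriv G = - (fps_expansion \<omega> 0 *
           (fps_const (of_nat n * (a - b)) * G + fps_const b * (fps_X * fps_deriv G)))"
proof -
  define \<phi> where "\<phi> = fps_expansion f 0"
  define \<Omega> where "\<Omega> = fps_expansion \<omega> 0"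
  define u where "u = fps_shift 1 \<phi>"
  have fe: "f has_fps_expansion \<phi>"
    unfolding \<phi>_def using f by (intro has_fps_expansion_fps_expansion[of "ball 0 1"]) auto
  have \<Omega>: "\<omega> has_fps_expansion \<Omega>"
    unfolding \<Omega>_def using \<omega> by (intro has_fps_expansion_fps_expansion[of "ball 0 1"]) auto
  have \<phi>0: "\<phi> $ 0 = 0" and u0: "u $ 0 = 1"
    using f by (simp_all add: \<phi>_def u_def fps_expansion_def)
  have \<phi>: "\<phi> = fps_X * u"
    unfolding u_def using \<phi>0 by (auto simp: fps_eq_iff)
  have "fps_X * fps_deriv \<phi> * (1 + fps_const b * \<Omega>) = \<phi> * (1 + fps_const a * \<Omega>)"
  proof (rule fps_expansion_unique_complex)
    show "(\<lambda>z. z * deriv f z * (1 + b * \<omega> z)) has_fps_expansion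
            fps_X * fps_deriv \<phi> * (1 + fps_const b * \<Omega>)"
      by (intro fps_expansion_intros fe \<Omega>)
    have "\<forall>\<^sub>F z in nhds 0. z \<in> ball 0 (1::real)"
      by (rule eventually_nhds_in_open) auto
    then have "\<forall>\<^sub>F z in nhds 0. z * deriv f z * (1 + b * \<omega> z) = f z * (1 + a * \<omega> z)"
      by eventually_elim (rule eq)
    moreover have "(\<lambda>z. f z * (1 + a * \<omega> z)) has_fps_expansion \<phi> * (1 + fps_const a * \<Omega>)"
      by (intro fps_expansion_intros fe \<Omega>)
    ultimately show "(\<lambda>z. z * deriv f z * (1 + b * \<omega> z)) has_fps_expansion \<phi> * (1 + fps_const a * \<Omega>)"
      by (rule iffD2[OF has_fps_expansion_cong[OF _ refl]])
  qed
  then have ode: "fps_X * fps_deriv (inverse u ^ n) = - (\<Omega> * (fps_const (of_nat n * (a - b)) * inverse u ^ n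
                + fps_const b * (fps_X * fps_deriv (inverse u ^ n))))"
    unfolding \<phi> by (intro fps_starlike_equation_inverse_power u0 n)
  have "of_nat n * fps_expansion F 0 $ n = (inverse u ^ n) $ (n - 1)"
    using fps_expansion_local_inverse[OF f(1,2) F] n
    by (intro fps_lagrange_inversion u0) (simp_all flip: \<phi>_def \<phi>)
  then show ?thesis
    using ode u0 by (intro that[of "inverse u ^ n"]) (auto simp: taylor_coeff_def \<Omega>_def fps_power_zeroth)
qed

lemma one_plus_mult_ne_zero:
  fixes w :: complex
  assumes "-1 \<le> B" "B \<le> 1" "norm w < 1"
  shows "1 + of_real B * w \<noteq> 0"
proof
  assume "1 + of_real B * w = 0"
  then have "of_real B * w = - 1"
    by (simp add: add_eq_0_iff)
  then have "\<bar>B\<bar> * norm w = 1"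
    by (metis norm_minus_cancel norm_mult norm_of_real norm_one)
  moreover have "\<bar>B\<bar> * norm w \<le> 1 * norm w"
    using assms by (intro mult_right_mono) auto
  ultimately show False
    using assms by simp
qed

lemma janowski_starlikeE:
  assumes "-1 \<le> B" "B \<le> 1" and "f \<in> janowski_starlike A B"
  obtains \<omega> where "\<omega> holomorphic_on ball 0 1" "\<omega> 0 = 0" "\<omega> ` ball 0 1 \<subseteq> ball 0 1"
    and "\<And>z. z \<in> ball 0 1 \<Longrightarrow>
           z * deriv f z * (1 + of_real B * \<omega> z) = f z * (1 + of_real A * \<omega> z)"
proof -
  from assms(3) have f0: "f 0 = 0" and fnz: "\<And>z. z \<in> ball 0 1 - {0} \<Longrightarrow> f z \<noteq> 0"
    and sub: "(\<lambda>z. if z = 0 then 1 else z * deriv f z / f z)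
                \<prec>\<prec> (\<lambda>z. (1 + of_real A * z) / (1 + of_real B * z))"
    by (auto simp: janowski_starlike_def)
  from sub obtain \<omega> where \<omega>: "\<omega> holomorphic_on ball 0 1" "\<omega> 0 = 0" "\<omega> ` ball 0 1 \<subseteq> ball 0 1"
    and q: "\<And>z. z \<in> ball 0 1 \<Longrightarrow> (if z = 0 then 1 else z * deriv f z / f z)
              = (1 + of_real A * \<omega> z) / (1 + of_real B * \<omega> z)"
    unfolding subordinate_def by blast
  have "z * deriv f z * (1 + of_real B * \<omega> z) = f z * (1 + of_real A * \<omega> z)" if z: "z \<in> ball 0 1" for z
  proof (cases "z = 0")
    case False
    have "norm (\<omega> z) < 1"
      using \<omega>(3) z by (auto simp: image_subset_iff)
    then have "1 + of_real B * \<omega> z \<noteq> 0"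
      by (rule one_plus_mult_ne_zero[OF assms(1,2)])
    then show ?thesis
      using q[OF z] fnz[of z] z False by (simp add: field_simps)
  qed (simp add: f0)
  then show ?thesis
    by (rule that[OF \<omega>])
qed

text \<open>
  Clunie's inequality for \<open>(z / f z)\<^sup>n\<close>, with the terms below order \<open>m\<close> collected on the right; this is
  the only property of \<open>f\<close> that the upper bounds rest on.
\<close>
lemma janowski_inverse_coefficient_inequality:
  assumes AB: "-1 \<le> B" "B < A" "A \<le> 1" and f: "f \<in> janowski_starlike A B"
    and F: "local_inverse_at_0 f F" and n: "n \<ge> 1"
  obtains G :: "complex fps" where "G $ 0 = 1" and "of_nat n * taylor_coeff F n = G $ (n - 1)"
    and "\<And>m. (real m)\<^sup>2 * (norm (G $ m))\<^sup>2
           \<le> (\<Sum>k<m. ((real n * (A - B) + B * real k)\<^sup>2 - (real k)\<^sup>2) * (norm (G $ k))\<^sup>2)"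
proof -
  have hol: "f holomorphic_on ball 0 1" "f 0 = 0" "deriv f 0 = 1"
    using f by (auto simp: janowski_starlike_def)
  have B1: "B \<le> 1"
    using AB by simp
  obtain \<omega> where \<omega>: "\<omega> holomorphic_on ball 0 1" "\<omega> 0 = 0" "\<omega> ` ball 0 1 \<subseteq> ball 0 1"
    and eq: "\<And>z. z \<in> ball 0 1 \<Longrightarrow>
           z * deriv f z * (1 + of_real B * \<omega> z) = f z * (1 + of_real A * \<omega> z)"
    using janowski_starlikeE[OF AB(1) B1 f] by metis
  obtain G where G: "G $ 0 = 1" "of_nat n * taylor_coeff F n = G $ (n - 1)"
    and ode: "fps_X * fps_deriv G = - (fps_expansion \<omega> 0 *
           (fps_const (of_nat n * (of_real A - of_real B)) * G
            + fps_const (of_real B) * (fps_X * fps_deriv G)))"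
    by (rule inverse_coefficient_equation[OF hol F n \<omega>(1) eq])
  have nrm: "norm (of_nat n * (of_real A - of_real B) + of_real B * of_nat k :: complex)
           = \<bar>real n * (A - B) + B * real k\<bar>" for k
  proof -
    have "of_nat n * (of_real A - of_real B) + of_real B * of_nat k
        = complex_of_real (real n * (A - B) + B * real k)"
      by simp
    then show ?thesis
      by (metis norm_of_real)
  qed
  have "(real m)\<^sup>2 * (norm (G $ m))\<^sup>2
           \<le> (\<Sum>k<m. ((real n * (A - B) + B * real k)\<^sup>2 - (real k)\<^sup>2) * (norm (G $ k))\<^sup>2)" for m
    using clunie_coefficient_inequality[OF \<omega> ode, of m]
    by (simp add: nrm left_diff_distrib sum_subtractf flip: lessThan_Suc_atMost)
  then show ?thesis
    by (rule that[OF G])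
qed

section \<open>Extremal functions\<close>

lemma local_inverse_at_0_exists:
  assumes f: "f holomorphic_on ball 0 1" "f 0 = 0" "deriv f 0 \<noteq> 0"
  obtains F where "local_inverse_at_0 f F"
proof -
  obtain r where r: "r > 0" "ball 0 r \<subseteq> ball (0::complex) 1" "open (f ` ball 0 r)" "inj_on f (ball 0 r)"
    using has_complex_derivative_locally_invertible[OF f(1) _ open_ball f(3)] by auto
  have holr: "f holomorphic_on ball 0 r"
    using f(1) r(2) by (rule holomorphic_on_subset)
  obtain F where F: "F holomorphic_on f ` ball 0 r" "\<And>z. z \<in> ball 0 r \<Longrightarrow> F (f z) = z"
    using holomorphic_has_inverse[OF holr open_ball r(4)] by metis
  have "homeomorphism (ball 0 r) (f ` ball 0 r) f F"
    using F holr unfolding homeomorphism_def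
    by (force intro: holomorphic_on_imp_continuous_on)
  moreover have "0 \<in> f ` ball 0 r"
    using f(2) r(1) by (metis centre_in_ball imageI)
  ultimately have "local_inverse_at_0 f F"
    unfolding local_inverse_at_0_def using r F(1)
    by (intro exI[of _ "ball 0 r"] exI[of _ "f ` ball 0 r"]) auto
  then show ?thesis ..
qed

text \<open>
  The solution of \<open>z f' / f = (1 + A z\<^sup>q) / (1 + B z\<^sup>q)\<close>, i.e. \<open>z (1 + B z\<^sup>q)\<^bsup>(A-B)/(Bq)\<^esup>\<close>, or
  \<open>z exp (A z\<^sup>q / q)\<close> for \<open>B = 0\<close>; writing it as \<open>z exp h\<close> with a primitive \<open>h\<close> covers both cases.
\<close>
lemma janowski_starlike_extremal:
  assumes AB: "-1 \<le> B" "B < A" "A \<le> 1" and q: "q \<ge> 1"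
  obtains f where "f \<in> janowski_starlike A B"
    and "\<And>z. z \<in> ball 0 1 \<Longrightarrow>
           z * deriv f z * (1 + of_real B * z ^ q) = f z * (1 + of_real A * z ^ q)"
proof -
  have nrm: "norm (z ^ q) < 1" if "z \<in> ball 0 1" for z :: complex
    using that q by (simp add: norm_power power_less_one_iff)
  have nz: "1 + of_real B * w \<noteq> 0" if "norm w < 1" for w :: complex
    using AB that by (intro one_plus_mult_ne_zero) auto
  have nzq: "1 + of_real B * z ^ q \<noteq> 0" if "z \<in> ball 0 1" for z :: complex
    using nz nrm that by blast
  define p where "p = (\<lambda>z. of_real (A - B) * z ^ (q - 1) / (1 + of_real B * z ^ q) :: complex)"
  have p: "p holomorphic_on ball 0 1"
    unfolding p_def using nzq by (intro holomorphic_intros) auto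
  obtain h0 where h0: "\<And>z. z \<in> ball 0 1 \<Longrightarrow> (h0 has_field_derivative p z) (at z within ball 0 1)"
    using holomorphic_convex_primitive'[OF convex_ball open_ball p] by metis
  define h where "h = (\<lambda>z. h0 z - h0 0)"
  have h: "(h has_field_derivative p z) (at z)" if "z \<in> ball 0 1" for z
    using DERIV_diff[OF h0[OF that] DERIV_const] that
    unfolding h_def at_within_open[OF that open_ball] by simp
  define f where "f = (\<lambda>z. z * exp (h z))"
  have f': "(f has_field_derivative exp (h z) * (1 + z * p z)) (at z)" if "z \<in> ball 0 1" for z
    unfolding f_def using h[OF that] by (auto intro!: derivative_eq_intros simp: algebra_simps)
  have df: "deriv f z = exp (h z) * (1 + z * p z)" if "z \<in> ball 0 1" for z
    using f'[OF that] by (rule DERIV_imp_deriv)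
  have hol: "f holomorphic_on ball 0 1"
    unfolding holomorphic_on_open[OF open_ball] using f' by blast
  have eq: "z * deriv f z * (1 + of_real B * z ^ q) = f z * (1 + of_real A * z ^ q)"
    if z: "z \<in> ball 0 1" for z
  proof -
    have "p z * (1 + of_real B * z ^ q) = of_real (A - B) * z ^ (q - 1)"
      by (rule iffD1[OF nonzero_eq_divide_eq[OF nzq[OF z]]]) (simp only: p_def)
    then have "z * p z * (1 + of_real B * z ^ q) = of_real (A - B) * (z * z ^ (q - 1))"
      by (simp only: mult.assoc mult.left_commute)
    also have "z * z ^ (q - 1) = z ^ q"
      using q by (simp flip: power_Suc)
    finally have zp: "z * p z * (1 + of_real B * z ^ q) = of_real (A - B) * z ^ q" .
    have "z * deriv f z * (1 + of_real B * z ^ q)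
        = z * exp (h z) * (1 + of_real B * z ^ q + z * p z * (1 + of_real B * z ^ q))"
      by (simp add: df[OF z] algebra_simps)
    then show ?thesis
      unfolding zp by (simp add: f_def algebra_simps)
  qed
  have "f \<in> janowski_starlike A B"
    unfolding janowski_starlike_def mem_Collect_eq
  proof (intro conjI ballI)
    show "f holomorphic_on ball 0 1"
      by (rule hol)
    show "f 0 = 0" "deriv f 0 = 1"
      using df[of 0] by (simp_all add: f_def h_def)
    show fnz: "f z \<noteq> 0" if "z \<in> ball 0 1 - {0}" for z
      using that by (simp add: f_def)
    have quot: "(if z = 0 then 1 else z * deriv f z / f z) = (1 + of_real A * z ^ q) / (1 + of_real B * z ^ q)"
      if z: "z \<in> ball 0 1" for z
    proof (cases "z = 0")
      case True
      then show ?thesis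
        using q by (simp add: power_0_left)
    next
      case False
      then have "f z \<noteq> 0"
        using fnz z by simp
      from frac_eq_eq[OF this nzq[OF z]] show ?thesis
        using eq[OF z] False by (simp only: if_False mult.commute[of "f z"])
    qed
    show "(\<lambda>z. if z = 0 then 1 else z * deriv f z / f z)
            \<prec>\<prec> (\<lambda>z. (1 + of_real A * z) / (1 + of_real B * z))"
      unfolding subordinate_def
    proof (intro conjI exI[of _ "\<lambda>z. z ^ q"] ballI)
      have "(\<lambda>z. (1 + of_real A * z ^ q) / (1 + of_real B * z ^ q)) holomorphic_on ball (0::complex) 1"
        using nzq by (intro holomorphic_intros) auto
      then show "(\<lambda>z. if z = 0 then 1 else z * deriv f z / f z) holomorphic_on ball 0 1"
        by (rule holomorphic_transform) (rule quot[symmetric])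
      show "(\<lambda>z. (1 + of_real A * z) / (1 + of_real B * z)) holomorphic_on ball (0::complex) 1"
        using nz by (intro holomorphic_intros) auto
      show "(\<lambda>z. z ^ q) ` ball 0 1 \<subseteq> ball (0::complex) 1"
        using nrm by auto
    qed (use q quot in \<open>auto intro!: holomorphic_intros\<close>)
  qed
  then show ?thesis
    by (rule that) (rule eq)
qed

text \<open>
  For \<open>\<omega> = z\<^sup>q\<close> the equation \<open>z G' = - \<omega> (C G + B z G')\<close> determines each coefficient from the one \<open>q\<close>
  places before.
\<close>
lemma janowski_extremal_coefficient_recursion:
  assumes AB: "-1 \<le> B" "B < A" "A \<le> 1" and q: "q \<ge> 1" and n: "n \<ge> 1"
  obtains f F and G :: "complex fps"
  where "f \<in> janowski_starlike A B" "local_inverse_at_0 f F"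
    and "G $ 0 = 1" and "of_nat n * taylor_coeff F n = G $ (n - 1)"
    and "\<And>k. real (k + q) * norm (G $ (k + q)) = \<bar>real n * (A - B) + B * real k\<bar> * norm (G $ k)"
proof -
  obtain f where f: "f \<in> janowski_starlike A B"
    and eq: "\<And>z. z \<in> ball 0 1 \<Longrightarrow>
           z * deriv f z * (1 + of_real B * z ^ q) = f z * (1 + of_real A * z ^ q)"
    using janowski_starlike_extremal[OF AB q] by metis
  have hol: "f holomorphic_on ball 0 1" "f 0 = 0" "deriv f 0 = 1"
    using f by (auto simp: janowski_starlike_def)
  obtain F where F: "local_inverse_at_0 f F"
    using local_inverse_at_0_exists[OF hol(1,2)] hol(3) by auto
  have "(\<lambda>z. z ^ q) holomorphic_on ball (0::complex) 1"
    by (intro holomorphic_intros)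
  then obtain G where G: "G $ 0 = 1" "of_nat n * taylor_coeff F n = G $ (n - 1)"
    and ode: "fps_X * fps_deriv G = - (fps_expansion (\<lambda>z. z ^ q) 0 *
           (fps_const (of_nat n * (of_real A - of_real B)) * G
            + fps_const (of_real B) * (fps_X * fps_deriv G)))"
    by (rule inverse_coefficient_equation[OF hol F n _ eq])
  have X: "fps_expansion (\<lambda>z. z ^ q) 0 = (fps_X ^ q :: complex fps)"
    by (intro fps_expansion_eqI has_fps_expansion_fps_X_power)
  have XG: "(fps_X * fps_deriv G) $ k = of_nat k * G $ k" for k
    by (cases k) simp_all
  have "real (k + q) * norm (G $ (k + q)) = \<bar>real n * (A - B) + B * real k\<bar> * norm (G $ k)" for k
  proof -
    have "of_nat (k + q) * G $ (k + q)
        = (- (fps_X ^ q * (fps_const (of_nat n * (of_real A - of_real B)) * G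
            + fps_const (of_real B) * (fps_X * fps_deriv G)))) $ (k + q)"
      using ode unfolding X XG[symmetric] by simp
    also have "\<dots> = - (of_nat n * (of_real A - of_real B) * G $ k + of_real B * (of_nat k * G $ k))"
      by (simp add: fps_X_power_mult_nth)
    also have "\<dots> = - (of_real (real n * (A - B) + B * real k) * G $ k)"
      by (simp add: algebra_simps)
    finally show ?thesis
      by (metis norm_minus_cancel norm_mult norm_of_nat norm_of_real)
  qed
  then show ?thesis
    by (rule that[OF f F G])
qed

section \<open>The coefficient bounds\<close>

text \<open>
  For \<open>\<delta>\<close> in the \<open>k\<close>-th interval the weight \<open>(n (A - B) + B i)\<^sup>2 - i\<^sup>2\<close> changes sign at \<open>i = n - k\<close>:
  it is \<open>(n (A - B) - (1 - B) i) (n (A - B) + (1 + B) i)\<close>, and \<open>1 - \<delta> = (A - B) / (1 - B)\<close>.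
\<close>
lemma weight_sign_change:
  fixes A B \<delta> :: real
  assumes AB: "-1 \<le> B" "B < A" "A \<le> 1" and n: "n \<ge> 1" and \<delta>: "\<delta> = (1 - A) / (1 - B)"
    and k: "k < n" and mem: "\<delta> \<in> subinterval n k"
  shows "i < n - k \<Longrightarrow> real i \<le> real n * (A - B) + B * real i"
    and "n - k \<le> i \<Longrightarrow> (real n * (A - B) + B * real i)\<^sup>2 \<le> (real i)\<^sup>2"
proof -
  have B: "1 - B > 0"
    using AB by simp
  have d: "\<delta> * (1 - B) = 1 - A"
    using B by (simp add: \<delta>)
  have "real k \<le> real n * \<delta>" "real n * \<delta> < real k + 1"
    using mem n by (auto simp: subinterval_def field_simps)
  then have "real k * (1 - B) \<le> real n * \<delta> * (1 - B)" "real n * \<delta> * (1 - B) < (real k + 1) * (1 - B)"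
    using B by (auto intro: mult_right_mono)
  then have lo: "real k * (1 - B) \<le> real n * (1 - A)" and hi: "real n * (1 - A) < (real k + 1) * (1 - B)"
    by (simp_all add: mult.assoc d)
  show "real i \<le> real n * (A - B) + B * real i" if "i < n - k"
  proof -
    have "(real i + real k + 1) * (1 - B) \<le> real n * (1 - B)"
      using that B by (intro mult_right_mono) auto
    then show ?thesis
      using hi by (simp add: algebra_simps)
  qed
  show "(real n * (A - B) + B * real i)\<^sup>2 \<le> (real i)\<^sup>2" if "n - k \<le> i"
  proof -
    have "real n * (1 - B) \<le> (real i + real k) * (1 - B)"
      using that B by (intro mult_right_mono) auto
    then have up: "real n * (A - B) + B * real i \<le> real i"
      using lo by (simp add: algebra_simps)
    have "0 \<le> real n * (A - B)" "0 \<le> (1 + B) * real i"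
      using AB by simp_all
    then have "- real i \<le> real n * (A - B) + B * real i"
      by (simp add: algebra_simps)
    with up show ?thesis
      by (simp add: abs_le_square_iff[symmetric] abs_le_iff)
  qed
qed

lemma weight_prod_nonneg:
  fixes A B \<delta> :: real
  assumes "-1 \<le> B" "B < A" "A \<le> 1" and "n \<ge> 1" and "\<delta> = (1 - A) / (1 - B)"
    and "k < n" and "\<delta> \<in> subinterval n k" and "m \<le> n - k"
  shows "0 \<le> (\<Prod>j<m. (real n * (A - B) + B * real j) / (real j + 1))"
proof (intro prod_nonneg ballI divide_nonneg_pos)
  fix j assume "j \<in> {..<m}"
  then have "j < n - k"
    using assms by simp
  from weight_sign_change(1)[OF assms(1-7) this]
  show "0 \<le> real n * (A - B) + B * real j"
    by (rule order.trans[rotated]) simp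
qed auto

theorem theorem3p3:
  fixes A B \<delta> :: real and n :: nat
  assumes "-1 \<le> B" and "B < A" and "A \<le> 1" and "n \<ge> 2"
    and "\<delta> = (1 - A) / (1 - B)"
  shows
    "(\<forall>f \<in> janowski_starlike A B. \<forall>F. local_inverse_at_0 f F \<longrightarrow>
        (\<delta> \<in> subinterval n 0 \<union> subinterval n 1 \<longrightarrow>
           norm (taylor_coeff F n)
             \<le> 1 / real n * (\<Prod>j = 0..n - 2. (real n * (A - B) + B * real j) / (real j + 1))) \<and>
        (\<forall>k \<in> {2..n - 2}. \<delta> \<in> subinterval n k \<longrightarrow>
           norm (taylor_coeff F n)
             \<le> (real n - real k) / (real n * (real n - 1)) *
               (\<Prod>j = 0..n - k - 1. (real n * (A - B) + B * real j) / (real j + 1))) \<and>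
        (\<delta> \<in> subinterval n (n - 1) \<longrightarrow>
           norm (taylor_coeff F n) \<le> (A - B) / (real n - 1))) \<and>
     (\<delta> \<in> subinterval n 0 \<union> subinterval n 1 \<longrightarrow>
        (\<exists>f \<in> janowski_starlike A B. \<exists>F. local_inverse_at_0 f F \<and>
           norm (taylor_coeff F n)
             = 1 / real n * (\<Prod>j = 0..n - 2. (real n * (A - B) + B * real j) / (real j + 1)))) \<and>
     (\<delta> \<in> subinterval n (n - 1) \<longrightarrow>
        (\<exists>f \<in> janowski_starlike A B. \<exists>F. local_inverse_at_0 f F \<and>
           norm (taylor_coeff F n) = (A - B) / (real n - 1)))"
proof -
  note AB = assms(1-3)
  have n1: "n \<ge> 1"
    using assms(4) by simp
  define P where "P = (\<lambda>m. \<Prod>j<m. (real n * (A - B) + B * real j) / (real j + 1))"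
  have P_atMost: "(\<Prod>j = 0..m. (real n * (A - B) + B * real j) / (real j + 1)) = P (Suc m)" for m
    by (simp add: P_def atLeast0AtMost lessThan_Suc_atMost)
  have P_nonneg: "0 \<le> P m" if "k < n" "\<delta> \<in> subinterval n k" "m \<le> n - k" for k m
    unfolding P_def by (rule weight_prod_nonneg[OF AB n1 assms(5) that])
  have weight_ge: "(real i)\<^sup>2 \<le> (real n * (A - B) + B * real i)\<^sup>2"
    if "k < n" "\<delta> \<in> subinterval n k" "i < n - k" for i k
    using weight_sign_change(1)[OF AB n1 assms(5) that] by (intro power_mono) auto
  note weight_le = weight_sign_change(2)[OF AB n1 assms(5)]
  have upper: "(\<delta> \<in> subinterval n 0 \<union> subinterval n 1 \<longrightarrow> norm (taylor_coeff F n) \<le> 1 / real n * P (n - 1)) \<and>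
      (\<forall>k. 1 \<le> k \<and> k < n \<and> \<delta> \<in> subinterval n k \<longrightarrow>
         norm (taylor_coeff F n) \<le> (real n - real k) / (real n * (real n - 1)) * P (n - k))"
    if f: "f \<in> janowski_starlike A B" and F: "local_inverse_at_0 f F" for f F
  proof -
    obtain G :: "complex fps" where G0: "G $ 0 = 1" and coeff: "of_nat n * taylor_coeff F n = G $ (n - 1)"
      and clunie: "\<And>m. (real m)\<^sup>2 * (norm (G $ m))\<^sup>2
           \<le> (\<Sum>k<m. ((real n * (A - B) + B * real k)\<^sup>2 - (real k)\<^sup>2) * (norm (G $ k))\<^sup>2)"
      by (rule janowski_inverse_coefficient_inequality[OF AB f F n1]) (rule that)
    have G0': "(norm (G $ 0))\<^sup>2 = 1"
      by (simp add: G0)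
    have nrm: "real n * norm (taylor_coeff F n) = norm (G $ (n - 1))"
      by (metis coeff norm_mult norm_of_nat)
    have "norm (taylor_coeff F n) \<le> 1 / real n * P (n - 1)"
      if k: "k \<le> 1" "\<delta> \<in> subinterval n k" for k
    proof -
      have kn: "k < n" "n - 1 \<le> n - k"
        using k assms(4) by auto
      (* The weights used are those of index at most n - 2, so one interval more is admissible
         than non-negativity up to n - 1 would allow. *)
      have "(norm (G $ (n - 1)))\<^sup>2 \<le> (P (n - 1))\<^sup>2"
        unfolding P_def using kn
        by (intro clunie_product_bound clunie G0' weight_ge[OF kn(1) k(2)]) auto
      then have "norm (G $ (n - 1)) \<le> P (n - 1)"
        by (rule power2_le_imp_le) (rule P_nonneg[OF kn(1) k(2) kn(2)])
      then show ?thesis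
        using n1 nrm by (simp add: field_simps)
    qed
    moreover have "norm (taylor_coeff F n) \<le> (real n - real k) / (real n * (real n - 1)) * P (n - k)"
      if k: "1 \<le> k" "k < n" "\<delta> \<in> subinterval n k" for k
    proof -
      have "(real (n - 1) * norm (G $ (n - 1)))\<^sup>2 \<le> (real (n - k) * P (n - k))\<^sup>2"
        unfolding P_def using k
        by (intro clunie_truncated_bound clunie G0' weight_ge[OF k(2,3)] weight_le[OF k(2,3)]) auto
      then have "real (n - 1) * norm (G $ (n - 1)) \<le> real (n - k) * P (n - k)"
        by (rule power2_le_imp_le) (intro mult_nonneg_nonneg P_nonneg[OF k(2,3)], simp_all)
      then have "(real n - 1) * (real n * norm (taylor_coeff F n)) \<le> (real n - real k) * P (n - k)"
        using k by (simp add: nrm of_nat_diff)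
      then show ?thesis
        using assms(4) by (simp add: field_simps)
    qed
    ultimately show ?thesis
      by auto
  qed
  have upper_last: "norm (taylor_coeff F n) \<le> (A - B) / (real n - 1)"
    if "f \<in> janowski_starlike A B" "local_inverse_at_0 f F" "\<delta> \<in> subinterval n (n - 1)" for f F
  proof -
    have "norm (taylor_coeff F n) \<le> (real n - real (n - 1)) / (real n * (real n - 1)) * P (n - (n - 1))"
      by (rule upper[OF that(1,2), THEN conjunct2, rule_format]) (use that(3) assms(4) in auto)
    also have "n - (n - 1) = 1"
      using n1 by simp
    also have "(real n - real (n - 1)) / (real n * (real n - 1)) * P 1 = (A - B) / (real n - 1)"
      using n1 by (simp add: P_def of_nat_diff)
    finally show ?thesis .
  qed
  (* The choice q = 1, i.e. f z = z (1 + B z) powr ((A - B) / B) for nonzero B. Up to sign, the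
     recursion is that of P; the sign of the factors is fixed by the position of \<delta>. *)
  have sharp_a: "\<exists>f \<in> janowski_starlike A B. \<exists>F. local_inverse_at_0 f F \<and>
      norm (taylor_coeff F n) = 1 / real n * P (n - 1)"
    if "\<delta> \<in> subinterval n 0 \<union> subinterval n 1"
  proof -
    obtain k where k: "k \<le> 1" "\<delta> \<in> subinterval n k"
      using \<open>\<delta> \<in> subinterval n 0 \<union> subinterval n 1\<close> by auto
    have kn: "k < n"
      using k assms(4) by auto
    obtain f F and G :: "complex fps"
      where fF: "f \<in> janowski_starlike A B" "local_inverse_at_0 f F"
        and G0: "G $ 0 = 1" and coeff: "of_nat n * taylor_coeff F n = G $ (n - 1)"
        and rec: "\<And>k. real (k + 1) * norm (G $ (k + 1)) = \<bar>real n * (A - B) + B * real k\<bar> * norm (G $ k)"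
      by (rule janowski_extremal_coefficient_recursion[OF AB order_refl n1]) (rule that)
    have "norm (G $ m) = \<bar>P m\<bar>" for m
    proof (induction m)
      case (Suc m)
      have "real (m + 1) * \<bar>P (Suc m)\<bar> = \<bar>real n * (A - B) + B * real m\<bar> * \<bar>P m\<bar>"
        by (simp add: P_def abs_mult add.commute)
      also have "\<dots> = real (m + 1) * norm (G $ (m + 1))"
        by (simp only: rec Suc.IH)
      finally show ?case by simp
    qed (simp add: P_def G0)
    moreover have "0 \<le> P (n - 1)"
      using k by (intro P_nonneg[OF kn k(2)]) auto
    ultimately have "real n * norm (taylor_coeff F n) = P (n - 1)"
      by (metis abs_of_nonneg coeff norm_mult norm_of_nat)
    then show ?thesis
      using fF n1 by (intro bexI[of _ f] exI[of _ F]) (auto simp: field_simps)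
  qed
  (* The choice q = n - 1, where the recursion leads from order 0 to order n - 1 at once. *)
  have sharp_b: "\<exists>f \<in> janowski_starlike A B. \<exists>F. local_inverse_at_0 f F \<and>
      norm (taylor_coeff F n) = (A - B) / (real n - 1)"
  proof -
    have q: "n - 1 \<ge> 1"
      using assms(4) by simp
    obtain f F and G :: "complex fps"
      where fF: "f \<in> janowski_starlike A B" "local_inverse_at_0 f F"
        and G0: "G $ 0 = 1" and coeff: "of_nat n * taylor_coeff F n = G $ (n - 1)"
        and rec: "\<And>k. real (k + (n - 1)) * norm (G $ (k + (n - 1)))
                      = \<bar>real n * (A - B) + B * real k\<bar> * norm (G $ k)"
      by (rule janowski_extremal_coefficient_recursion[OF AB q n1]) (rule that)
    have "(real n - 1) * norm (G $ (n - 1)) = real n * (A - B)"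
      using rec[of 0] AB n1 by (simp add: G0 of_nat_diff)
    moreover have "norm (G $ (n - 1)) = real n * norm (taylor_coeff F n)"
      by (metis coeff norm_mult norm_of_nat)
    ultimately have "real n * ((real n - 1) * norm (taylor_coeff F n)) = real n * (A - B)"
      by (simp only: mult.left_commute)
    then have "(real n - 1) * norm (taylor_coeff F n) = A - B"
      using n1 by simp
    then have "norm (taylor_coeff F n) = (A - B) / (real n - 1)"
      using assms(4) by (simp add: field_simps)
    with fF show ?thesis by blast
  qed
  have "Suc (n - 2) = n - 1"
    using assms(4) by simp
  then have P_a: "(\<Prod>j = 0..n - 2. (real n * (A - B) + B * real j) / (real j + 1)) = P (n - 1)"
    by (simp only: P_atMost)
  have P_ii: "(\<Prod>j = 0..n - k - 1. (real n * (A - B) + B * real j) / (real j + 1)) = P (n - k)"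
    if "k \<in> {2..n - 2}" for k
  proof -
    have "Suc (n - k - 1) = n - k"
      using that assms(4) by auto
    then show ?thesis
      by (simp only: P_atMost)
  qed
  have upper_ii: "norm (taylor_coeff F n) \<le> (real n - real k) / (real n * (real n - 1)) *
      (\<Prod>j = 0..n - k - 1. (real n * (A - B) + B * real j) / (real j + 1))"
    if "f \<in> janowski_starlike A B" "local_inverse_at_0 f F"
      and k: "k \<in> {2..n - 2}" "\<delta> \<in> subinterval n k" for f F k
    unfolding P_ii[OF k(1)]
    by (rule upper[OF that(1,2), THEN conjunct2, rule_format]) (use k assms(4) in auto)
  show ?thesis
    unfolding P_a
    by (intro conjI ballI allI impI upper[THEN conjunct1, rule_format] upper_ii upper_last sharp_a sharp_b)
qed

end
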